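(* Let $\mathcal K\subseteq\mathcal L\subseteq\mathcal F$ be fields such that $\mathcal F|\mathcal L$ and $\mathcal L|\mathcal K$ are finitely generated, and let $P$ be a place of $\mathcal F$ (not necessarily the identity on $\mathcal K$ or $\mathcal L$). If $(\mathcal F|\mathcal L,P)$ and $(\mathcal L|\mathcal K,P)$ are uniformizable, then $(\mathcal F|\mathcal K,P)$ is uniformizable.
   Context: Restrictions of $P$ to subfields are again denoted $P$. Uniformizability: let $\mathcal F|\mathcal K$ be a finitely generated field extension (possibly algebraic) and $P$ a place of $\mathcal F$, not necessarily the identity on $\mathcal K$. Let $\mathcal O_{\mathcal F}$, $\mathcal O_{\mathcal K}$ be the valuation rings of $P$ on $\mathcal F$, $\mathcal K$, and write $aP$ for the residue of $a$. For $\zeta_1,\ldots,\zeta_m\in\mathcal O_{\mathcal F}$, $(\mathcal F|\mathcal K,P)$ is uniformizable with respect to $\zeta_1,\ldots,\zeta_m$ if there are a transcendence basis $T=\{t_1,\ldots,t_s\}\subset\mathcal O_{\mathcal F}$ of $\mathcal F|\mathcal K$ (possibly empty), elements $\eta_1,\ldots,\eta_n\in\mathcal O_{\mathcal F}$ among which $\zeta_1,\ldots,\zeta_m$ appear, and polynomials $f_i\in\mathcal O_{\mathcal K}[t_1,\ldots,t_s,X_1,\ldots,X_n]$, $1\le i\le n$, such that $\mathcal F=\mathcal K(t_1,\ldots,t_s,\eta_1,\ldots,\eta_n)$ and: (U1) for $i<j$, $X_j$ does not occur in $f_i$; (U2) $f_i(\eta_1,\ldots,\eta_n)=0$ for $1\le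 i\le n$; (U3) $(\det J_f(\eta_1,\ldots,\eta_n))P\neq 0$, where $J_f=(\partial f_i/\partial X_j)_{i,j}$. $(\mathcal F|\mathcal K,P)$ is uniformizable if it is uniformizable with respect to every choice of finitely many elements of $\mathcal O_{\mathcal F}$. *)

theory Defs
  imports
    "HOL-Library.Poly_Mapping"
    "HOL-Algebra.Generated_Fields"
    "HOL-Algebra.Algebraic_Closure_Type"
    "Jordan_Normal_Form.Determinant"
begin

text \<open>
  All fields are subfields of one ambient field, the type \<open>'a\<close>. For subfields, generated
  subrings and subfields, and algebraic elements we use HOL-Algebra on the record \<open>amb\<close>
  of that type.
\<close>

abbreviation amb :: "'a::field ring" where
  "amb \<equiv> ring_of_type_algebra"

definition adjoin :: "'a::field set \<Rightarrow> 'a set \<Rightarrow> 'a set" where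
  "adjoin K S = generate_field amb (K \<union> S)"

definition fin_gen :: "'a::field set \<Rightarrow> 'a set \<Rightarrow> bool" where
  "fin_gen E K \<longleftrightarrow> (\<exists>S. finite S \<and> S \<subseteq> E \<and> E = adjoin K S)"


text \<open>
  Polynomials in variables \<open>X\<^sub>v\<close>, where \<open>v\<close> ranges over \<open>'v\<close>: finitely supported
  coefficient families indexed by exponent vectors.
\<close>

type_synonym ('v, 'a) mpoly = "('v \<Rightarrow>\<^sub>0 nat) \<Rightarrow>\<^sub>0 'a"

definition mpoly_vars :: "('v, 'a::zero) mpoly \<Rightarrow> 'v set" where
  "mpoly_vars p = (\<Union>m\<in>Poly_Mapping.keys p. Poly_Mapping.keys m)"

text \<open>\<open>mpoly_ring A V\<close> is \<open>A[X\<^sub>v | v \<in> V]\<close>, for a subring \<open>A\<close> of \<open>'a\<close>.\<close>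

definition mpoly_ring :: "'a::zero set \<Rightarrow> 'v set \<Rightarrow> ('v, 'a) mpoly set" where
  "mpoly_ring A V = {p. Poly_Mapping.range p \<subseteq> A \<and> mpoly_vars p \<subseteq> V}"

definition mpoly_eval :: "('v \<Rightarrow> 'a::comm_semiring_1) \<Rightarrow> ('v, 'a) mpoly \<Rightarrow> 'a" where
  "mpoly_eval x p =
     (\<Sum>m\<in>Poly_Mapping.keys p. Poly_Mapping.lookup p m *
        (\<Prod>v\<in>Poly_Mapping.keys m. x v ^ Poly_Mapping.lookup m v))"

text \<open>
  Formal partial derivative. Subtraction of exponents is truncated; where that matters the
  coefficient \<open>of_nat (lookup m v)\<close> vanishes.
\<close>

definition mpoly_deriv :: "'v \<Rightarrow> ('v, 'a::comm_semiring_1) mpoly \<Rightarrow> ('v, 'a) mpoly" where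
  "mpoly_deriv v p =
     (\<Sum>m\<in>Poly_Mapping.keys p.
        Poly_Mapping.single (m - Poly_Mapping.single v 1)
          (of_nat (Poly_Mapping.lookup m v) * Poly_Mapping.lookup p m))"

text \<open>\<open>J\<^sub>f(\<eta>)\<close>, with indices starting at 0.\<close>

definition jacobian :: "nat \<Rightarrow> (nat \<Rightarrow> (nat, 'a::comm_semiring_1) mpoly) \<Rightarrow> (nat \<Rightarrow> 'a) \<Rightarrow> 'a mat" where
  "jacobian n f \<eta> = mat n n (\<lambda>(i, j). mpoly_eval \<eta> (mpoly_deriv j (f i)))"


text \<open>The elements of \<open>T\<close> themselves serve as names of the variables, each evaluated at itself.\<close>

definition alg_indep :: "'a::field set \<Rightarrow> 'a set \<Rightarrow> bool" where
  "alg_indep K T \<longleftrightarrow>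
     (\<forall>p \<in> mpoly_ring K T. mpoly_eval (\<lambda>t. t) p = 0 \<longrightarrow> p = 0)"

definition transcendence_basis :: "'a::field set \<Rightarrow> 'a set \<Rightarrow> 'a set \<Rightarrow> bool" where
  "transcendence_basis E K T \<longleftrightarrow>
     T \<subseteq> E \<and> alg_indep K T \<and> (\<forall>x\<in>E. ring.algebraic amb (adjoin K T) x)"


text \<open>
  A place of \<open>E\<close> takes values in a field \<open>'r\<close> together with \<open>\<infinity>\<close>, represented by
  \<open>None\<close>: it is a ring homomorphism on the ring of elements with finite value, and the
  inverse of an element with value \<open>\<infinity>\<close> has value 0. (As \<open>inverse 0 = 0\<close>, the last
  clause forces \<open>P 0 \<noteq> None\<close>.) Values of \<open>P\<close> outside \<open>E\<close> are irrelevant, so the restriction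
  of \<open>P\<close> to a subfield of \<open>E\<close> is \<open>P\<close> itself.
\<close>

definition place :: "'a::field set \<Rightarrow> ('a \<Rightarrow> 'r::field option) \<Rightarrow> bool" where
  "place E P \<longleftrightarrow>
     P 1 = Some 1 \<and>
     (\<forall>a\<in>E. \<forall>b\<in>E. \<forall>\<alpha> \<beta>. P a = Some \<alpha> \<longrightarrow> P b = Some \<beta> \<longrightarrow>
        P (a + b) = Some (\<alpha> + \<beta>) \<and> P (a * b) = Some (\<alpha> * \<beta>)) \<and>
     (\<forall>a\<in>E. P a = None \<longrightarrow> P (inverse a) = Some 0)"

definition val_ring :: "'a set \<Rightarrow> ('a \<Rightarrow> 'r option) \<Rightarrow> 'a set" where
  "val_ring E P = {a\<in>E. P a \<noteq> None}"


text \<open>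
  In \<open>uniformizable_wrt\<close> the polynomials have coefficients in the subring
  \<open>\<O>\<^sub>K[T]\<close> of the ambient field, which is a polynomial ring as \<open>T\<close> is algebraically
  independent over \<open>K\<close>. The variables \<open>X\<^sub>i\<close> and the elements \<open>\<eta>\<^sub>i\<close> are numbered by
  \<open>i < n\<close>.
\<close>

definition uniformizable_wrt ::
  "'a::field set \<Rightarrow> 'a set \<Rightarrow> ('a \<Rightarrow> 'r::field option) \<Rightarrow> 'a set \<Rightarrow> bool" where
  "uniformizable_wrt E K P Z \<longleftrightarrow>
     (\<exists>T n \<eta> f.
        finite T \<and> T \<subseteq> val_ring E P \<and> transcendence_basis E K T \<and>
        \<eta> ` {..<n} \<subseteq> val_ring E P \<and> Z \<subseteq> \<eta> ` {..<n} \<and>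
        (\<forall>i<n. f i \<in> mpoly_ring (generate_ring amb (val_ring K P \<union> T)) {..<n}) \<and>
        E = adjoin K (T \<union> \<eta> ` {..<n}) \<and>
        (\<forall>i j. i < j \<and> j < n \<longrightarrow> j \<notin> mpoly_vars (f i)) \<and>
        (\<forall>i<n. mpoly_eval \<eta> (f i) = 0) \<and>
        P (det (jacobian n f \<eta>)) \<noteq> Some 0)"

definition uniformizable ::
  "'a::field set \<Rightarrow> 'a set \<Rightarrow> ('a \<Rightarrow> 'r::field option) \<Rightarrow> bool" where
  "uniformizable E K P \<longleftrightarrow>
     (\<forall>Z. finite Z \<and> Z \<subseteq> val_ring E P \<longrightarrow> uniformizable_wrt E K P Z)"

end

theory Submission
  imports Defs
begin

text \<open>
  Start from a uniformizing system for \<open>F|L\<close> and the given elements. Its coefficients lie in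
  \<open>\<O>\<^sub>L[T]\<close>, so only finitely many elements of \<open>\<O>\<^sub>L\<close> occur in them. Uniformize \<open>L|K\<close>
  with respect to these elements: each of them is then one of the \<open>\<eta>\<^sub>j\<close> for \<open>L|K\<close> and can be
  replaced in the first system by the variable \<open>X\<^sub>j\<close>. Both Jacobians are lower triangular by
  (U1), and so is that of the combined system, whose diagonal consists of the two given
  diagonals. Hence its determinant is the product of the two determinants, which have nonzero
  finite residue.
\<close>

section \<open>The ambient field\<close>

lemma amb_simps [simp]:
  "carrier amb = (UNIV :: 'a::field set)"
  "\<one>\<^bsub>amb\<^esub> = (1::'a)"
  "\<zero>\<^bsub>amb\<^esub> = (0::'a)"
  "x \<otimes>\<^bsub>amb\<^esub> y = (x * y :: 'a)"
  "x \<oplus>\<^bsub>amb\<^esub> y = (x + y :: 'a)"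
  by (simp_all add: ring_of_type_algebra_def)

lemma amb_a_inv [simp]: "\<ominus>\<^bsub>amb\<^esub> x = (- x :: 'a::field)"
proof -
  interpret field "amb :: 'a ring" by (rule field_from_type_algebra)
  show ?thesis
    using minus_equality[of "- x" x] by simp
qed

lemma subring_ambD:
  fixes R :: "'a::field set"
  assumes "subring R amb"
  shows "0 \<in> R" "1 \<in> R" "x \<in> R \<Longrightarrow> - x \<in> R"
    "x \<in> R \<Longrightarrow> y \<in> R \<Longrightarrow> x + y \<in> R" "x \<in> R \<Longrightarrow> y \<in> R \<Longrightarrow> x * y \<in> R"
  using subringE[OF assms] by auto

lemma subring_ambI:
  fixes R :: "'a::field set"
  assumes "1 \<in> R" "\<And>x. x \<in> R \<Longrightarrow> - x \<in> R"
    "\<And>x y. x \<in> R \<Longrightarrow> y \<in> R \<Longrightarrow> x + y \<in> R" "\<And>x y. x \<in> R \<Longrightarrow> y \<in> R \<Longrightarrow> x * y \<in> R"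
  shows "subring R amb"
proof -
  interpret field "amb :: 'a ring" by (rule field_from_type_algebra)
  show ?thesis
    by (rule subringI) (use assms in auto)
qed

lemma subring_amb_sum:
  fixes R :: "'a::field set"
  assumes "subring R amb" "\<And>i. i \<in> A \<Longrightarrow> g i \<in> R"
  shows "sum g A \<in> R"
  using assms(2) by (induction A rule: infinite_finite_induct) (auto intro: subring_ambD[OF assms(1)])

lemma subring_amb_prod:
  fixes R :: "'a::field set"
  assumes "subring R amb" "\<And>i. i \<in> A \<Longrightarrow> g i \<in> R"
  shows "prod g A \<in> R"
  using assms(2) by (induction A rule: infinite_finite_induct) (auto intro: subring_ambD[OF assms(1)])

lemma subring_amb_power:
  fixes R :: "'a::field set"
  assumes "subring R amb" "x \<in> R"
  shows "x ^ n \<in> R"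
  by (induction n) (auto intro: subring_ambD[OF assms(1)] assms(2))

lemma subring_amb_of_nat:
  fixes R :: "'a::field set"
  assumes "subring R amb"
  shows "of_nat n \<in> R"
  by (induction n) (auto intro: subring_ambD[OF assms(1)])

section \<open>Generated subrings\<close>

lemma subring_generate_amb: "subring (generate_ring amb S) (amb :: 'a::field ring)"
  by (rule ring.generate_ring_is_subring) (auto intro: ring_from_type_algebra)

lemma generate_amb_subset:
  fixes S :: "'a::field set"
  assumes "subring R amb" "S \<subseteq> R"
  shows "generate_ring amb S \<subseteq> R"
  by (rule ring.generate_ring_min_subring1) (use assms in \<open>auto intro: ring_from_type_algebra\<close>)

lemma generate_amb_mono:
  fixes S :: "'a::field set"
  assumes "S \<subseteq> S'"
  shows "generate_ring amb S \<subseteq> generate_ring amb S'"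
  by (rule generate_amb_subset[OF subring_generate_amb]) (use assms in \<open>auto intro: generate_ring.incl\<close>)

text \<open>The elements reachable from finite parts of \<open>A\<close> together with
  \<open>T\<close> form a subring containing \<open>A\<close> and \<open>T\<close>, because two
  finite parts have a finite union. This is what reduces the coefficients in
  \<open>\<O>\<^sub>L[T]\<close> to finitely many elements of \<open>\<O>\<^sub>L\<close>.\<close>

lemma generate_ring_finite_part:
  fixes A :: "'a::field set"
  assumes "a \<in> generate_ring amb (A \<union> T)"
  shows "\<exists>C\<subseteq>A. finite C \<and> a \<in> generate_ring amb (C \<union> T)"
proof -
  define G where "G = {a. \<exists>C\<subseteq>A. finite C \<and> a \<in> generate_ring amb (C \<union> T)}"
  \<comment> \<open>Sum and product are treated at once: \<open>op\<close> is any operation under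
    which all subrings are closed, applied in the subring over \<open>C \<union> D\<close>.\<close>
  have binary: "op x y \<in> G"
    if xy: "x \<in> G" "y \<in> G"
      and op: "\<And>R :: 'a set. subring R amb \<Longrightarrow> x \<in> R \<Longrightarrow> y \<in> R \<Longrightarrow> op x y \<in> R" for op x y
  proof -
    obtain C D where C: "C \<subseteq> A" "finite C" "x \<in> generate_ring amb (C \<union> T)"
      and D: "D \<subseteq> A" "finite D" "y \<in> generate_ring amb (D \<union> T)"
      using xy by (auto simp: G_def)
    have "op x y \<in> generate_ring amb (C \<union> D \<union> T)"
      by (rule op[OF subring_generate_amb])
        (use C D generate_amb_mono[of "C \<union> T" "C \<union> D \<union> T"]
          generate_amb_mono[of "D \<union> T" "C \<union> D \<union> T"] in auto)
    with C D show ?thesis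
      by (auto simp: G_def intro!: exI[of _ "C \<union> D"])
  qed
  have "subring G amb"
  proof (rule subring_ambI)
    show "1 \<in> G"
      using subring_ambD(2)[OF subring_generate_amb] by (auto simp: G_def)
    show "- x \<in> G" if "x \<in> G" for x
      using that subring_ambD(3)[OF subring_generate_amb] by (auto simp: G_def)
    show "x + y \<in> G" "x * y \<in> G" if "x \<in> G" "y \<in> G" for x y
      by (rule binary[OF that], rule subring_ambD; assumption)+
  qed
  moreover have "x \<in> G" if "x \<in> A" for x
    using that by (auto simp: G_def intro!: exI[of _ "{x}"] generate_ring.incl)
  moreover have "x \<in> G" if "x \<in> T" for x
    using that by (auto simp: G_def intro!: exI[of _ "{}"] generate_ring.incl)
  ultimately have "generate_ring amb (A \<union> T) \<subseteq> G"
    by (intro generate_amb_subset) auto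
  with assms show ?thesis
    by (auto simp: G_def)
qed

section \<open>Adjunction and transitivity of algebraicity\<close>

lemma subfield_adjoin: "subfield (adjoin K S) (amb :: 'a::field ring)"
  unfolding adjoin_def
  by (rule field.generate_field_is_subfield) (auto intro: field_from_type_algebra)

lemma adjoin_incl: "K \<subseteq> adjoin K S" "S \<subseteq> adjoin K S"
  by (auto simp: adjoin_def intro: generate_field.incl)

lemma adjoin_subset:
  fixes E :: "'a::field set"
  assumes "subfield E amb" "K \<subseteq> E" "S \<subseteq> E"
  shows "adjoin K S \<subseteq> E"
  unfolding adjoin_def
  by (rule field.generate_field_min_subfield1) (use assms in \<open>auto intro: field_from_type_algebra\<close>)

lemma adjoin_adjoin: "adjoin (adjoin K S) S' = adjoin K (S \<union> S')" for K :: "'a::field set"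
proof
  show "adjoin (adjoin K S) S' \<subseteq> adjoin K (S \<union> S')"
    using adjoin_incl[where K = K and S = "S \<union> S'"] by (intro adjoin_subset subfield_adjoin) auto
  show "adjoin K (S \<union> S') \<subseteq> adjoin (adjoin K S) S'"
    using adjoin_incl[where K = K and S = S] adjoin_incl[where K = "adjoin K S" and S = S']
    by (intro adjoin_subset subfield_adjoin) auto
qed

text \<open>The coefficients of one annihilating polynomial of \<open>x\<close> generate a finite
  extension \<open>E\<close> of \<open>K\<close>. Since \<open>x\<close> is algebraic over
  \<open>E\<close>, the extension generated by \<open>x\<close> over \<open>E\<close> has finite
  dimension over \<open>K\<close>.\<close>

lemma (in field) algebraic_trans:
  assumes K: "subfield K R" and M: "subring M R" "\<And>y. y \<in> M \<Longrightarrow> (algebraic over K) y"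
    and x: "x \<in> carrier R" "(algebraic over M) x"
  shows "(algebraic over K) x"
proof -
  obtain p where p: "p \<in> carrier (M[X])" "p \<noteq> []" "eval p x = \<zero>"
    using algebraicE[OF M(1) x] by blast
  have set_p: "set p \<subseteq> M"
    using polynomial_incl p(1) by (simp add: univ_poly_carrier[symmetric])
  have carr: "set p \<subseteq> carrier R"
    using set_p subringE(1)[OF M(1)] by auto
  \<comment> \<open>A polynomial is the list of its coefficients, so \<open>p\<close> itself serves
    as the list of generators.\<close>
  define E where "E = finite_extension K p"
  have alg: "\<And>y. y \<in> set p \<Longrightarrow> (algebraic over K) y"
    using set_p M(2) by auto
  have E: "subfield E R" "finite_dimension K E" "set p \<subseteq> E"
    using finite_extension_is_subfield[OF K carr alg] finite_extension_finite_dimension(1)[OF K carr alg]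
      finite_extension_mem[OF subfieldE(1)[OF K] carr] by (auto simp: E_def)
  have "p \<in> carrier (E[X])"
    using p(1,2) E(3) by (auto simp: univ_poly_carrier[symmetric] polynomial_def)
  hence "(algebraic over E) x"
    using algebraicI p by blast
  hence "finite_dimension E (simple_extension E x)"
    using finite_dimension_simple_extension[OF E(1) x(1)] by simp
  hence "finite_dimension K (simple_extension E x)"
    using telescopic_base_dim(1)[OF K E(1,2)] by blast
  thus ?thesis
    using finite_dimension_imp_algebraic[OF K simple_extension_is_subring[OF subfieldE(1)[OF E(1)] x(1)]]
      simple_extension_mem[OF subfieldE(1)[OF E(1)] x(1)] by blast
qed


section \<open>Evaluation and formal derivatives of polynomials\<close>

definition mon_eval :: "('v \<Rightarrow> 'a::comm_semiring_1) \<Rightarrow> ('v \<Rightarrow>\<^sub>0 nat) \<Rightarrow> 'a" where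
  "mon_eval x m = (\<Prod>v\<in>Poly_Mapping.keys m. x v ^ Poly_Mapping.lookup m v)"

text \<open>New indices contribute only factors with exponent 0. A common index set allows termwise
  computation with different supports; the analogous lemmas for \<open>mpoly_eval\<close> and
  \<open>mpoly_deriv\<close> serve the same end.\<close>

lemma mon_eval_superset:
  assumes "finite V" "Poly_Mapping.keys m \<subseteq> V"
  shows "mon_eval x m = (\<Prod>v\<in>V. x v ^ Poly_Mapping.lookup m v)"
  unfolding mon_eval_def
  by (rule prod.mono_neutral_left) (use assms in \<open>auto simp: in_keys_iff\<close>)

lemma mon_eval_0 [simp]: "mon_eval x 0 = 1"
  by (simp add: mon_eval_def)

lemma mon_eval_single [simp]: "mon_eval x (Poly_Mapping.single v e) = x v ^ e"
  by (cases "e = 0") (simp_all add: mon_eval_def)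

lemma mon_eval_add: "mon_eval x (m + m') = mon_eval x m * mon_eval x m'"
proof -
  let ?V = "Poly_Mapping.keys m \<union> Poly_Mapping.keys m'"
  have "mon_eval x (m + m') = (\<Prod>v\<in>?V. x v ^ Poly_Mapping.lookup (m + m') v)"
    by (rule mon_eval_superset) (use keys_add[of m m'] in auto)
  also have "\<dots> = (\<Prod>v\<in>?V. x v ^ Poly_Mapping.lookup m v) * (\<Prod>v\<in>?V. x v ^ Poly_Mapping.lookup m' v)"
    by (simp add: lookup_add power_add prod.distrib)
  also have "\<dots> = mon_eval x m * mon_eval x m'"
    by (simp add: mon_eval_superset[of ?V])
  finally show ?thesis .
qed

lemma mon_eval_cong:
  assumes "\<And>v. v \<in> Poly_Mapping.keys m \<Longrightarrow> x v = y v"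
  shows "mon_eval x m = mon_eval y m"
  unfolding mon_eval_def using assms by (intro prod.cong) auto

lemma mpoly_eval_superset:
  assumes "finite M" "Poly_Mapping.keys p \<subseteq> M"
  shows "mpoly_eval x p = (\<Sum>m\<in>M. Poly_Mapping.lookup p m * mon_eval x m)"
  unfolding mpoly_eval_def mon_eval_def[symmetric]
  by (rule sum.mono_neutral_left) (use assms in \<open>auto simp: in_keys_iff\<close>)

lemma mpoly_eval_0 [simp]: "mpoly_eval x 0 = 0"
  by (simp add: mpoly_eval_def)

lemma mpoly_eval_single [simp]: "mpoly_eval x (Poly_Mapping.single m c) = c * mon_eval x m"
  by (subst mpoly_eval_superset[of "{m}"]) auto

lemma mpoly_eval_add: "mpoly_eval x (p + q) = mpoly_eval x p + mpoly_eval x q"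
proof -
  let ?M = "Poly_Mapping.keys p \<union> Poly_Mapping.keys q"
  have "mpoly_eval x (p + q) = (\<Sum>m\<in>?M. Poly_Mapping.lookup (p + q) m * mon_eval x m)"
    by (rule mpoly_eval_superset) (use keys_add[of p q] in auto)
  also have "\<dots> = (\<Sum>m\<in>?M. Poly_Mapping.lookup p m * mon_eval x m) +
      (\<Sum>m\<in>?M. Poly_Mapping.lookup q m * mon_eval x m)"
    by (simp add: lookup_add distrib_right sum.distrib)
  also have "\<dots> = mpoly_eval x p + mpoly_eval x q"
    by (simp add: mpoly_eval_superset[of ?M])
  finally show ?thesis .
qed

lemma mpoly_eval_sum: "mpoly_eval x (\<Sum>i\<in>A. p i) = (\<Sum>i\<in>A. mpoly_eval x (p i))"
  by (induction A rule: infinite_finite_induct) (auto simp: mpoly_eval_add)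

lemma mpoly_eval_cong:
  assumes "\<And>v. v \<in> mpoly_vars p \<Longrightarrow> x v = y v"
  shows "mpoly_eval x p = mpoly_eval y p"
  unfolding mpoly_eval_def mon_eval_def[symmetric] using assms
  by (intro sum.cong arg_cong2[of _ _ _ _ "(*)"] mon_eval_cong) (auto simp: mpoly_vars_def)

section \<open>Formal partial derivatives\<close>

lemma mpoly_deriv_superset:
  assumes "finite M" "Poly_Mapping.keys p \<subseteq> M"
  shows "mpoly_deriv v p = (\<Sum>m\<in>M. Poly_Mapping.single (m - Poly_Mapping.single v 1)
    (of_nat (Poly_Mapping.lookup m v) * Poly_Mapping.lookup p m))"
  unfolding mpoly_deriv_def
  by (rule sum.mono_neutral_left) (use assms in \<open>auto simp: in_keys_iff\<close>)

lemma mpoly_deriv_0 [simp]: "mpoly_deriv v 0 = 0"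
  by (simp add: mpoly_deriv_def)

lemma mpoly_deriv_single [simp]:
  "mpoly_deriv v (Poly_Mapping.single m c) =
    Poly_Mapping.single (m - Poly_Mapping.single v 1) (of_nat (Poly_Mapping.lookup m v) * c)"
  by (subst mpoly_deriv_superset[of "{m}"]) auto

lemma mpoly_deriv_add: "mpoly_deriv v (p + q) = mpoly_deriv v p + mpoly_deriv v q"
proof -
  let ?M = "Poly_Mapping.keys p \<union> Poly_Mapping.keys q"
  let ?d = "\<lambda>p. \<Sum>m\<in>?M. Poly_Mapping.single (m - Poly_Mapping.single v 1)
    (of_nat (Poly_Mapping.lookup m v) * Poly_Mapping.lookup p m)"
  have "mpoly_deriv v (p + q) = ?d (p + q)"
    by (rule mpoly_deriv_superset) (use keys_add[of p q] in auto)
  also have "\<dots> = ?d p + ?d q"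
    by (simp add: lookup_add distrib_left single_add sum.distrib)
  also have "\<dots> = mpoly_deriv v p + mpoly_deriv v q"
    by (simp add: mpoly_deriv_superset[of ?M])
  finally show ?thesis .
qed

lemma mpoly_deriv_sum: "mpoly_deriv v (\<Sum>i\<in>A. p i) = (\<Sum>i\<in>A. mpoly_deriv v (p i))"
  by (induction A rule: infinite_finite_induct) (auto simp: mpoly_deriv_add)

lemma mpoly_deriv_not_var:
  assumes "v \<notin> mpoly_vars p"
  shows "mpoly_deriv v p = 0"
  unfolding mpoly_deriv_def
  by (rule sum.neutral) (use assms in \<open>auto simp: mpoly_vars_def in_keys_iff\<close>)


section \<open>Polynomials over a subring\<close>

text \<open>\<open>Poly_Mapping.range\<close> holds only the nonzero coefficients. As 0 lies in
  \<open>R\<close>, the condition can be put on all coefficients, so that closure can be checked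
  pointwise.\<close>

lemma mpoly_ring_iff:
  fixes R :: "'a::field set"
  assumes "subring R amb"
  shows "p \<in> mpoly_ring R V \<longleftrightarrow>
    (\<forall>m. Poly_Mapping.lookup p m \<in> R) \<and> (\<forall>m\<in>Poly_Mapping.keys p. Poly_Mapping.keys m \<subseteq> V)"
proof -
  have "Poly_Mapping.range p \<subseteq> R \<longleftrightarrow> (\<forall>m. Poly_Mapping.lookup p m \<in> R)"
  proof (intro iffI allI)
    fix m assume "Poly_Mapping.range p \<subseteq> R"
    thus "Poly_Mapping.lookup p m \<in> R"
      using subring_ambD(1)[OF assms] in_keys_lookup_in_range[of m p]
      by (cases "m \<in> Poly_Mapping.keys p") (auto simp: in_keys_iff)
  qed (auto simp: range.rep_eq)
  thus ?thesis
    by (auto simp: mpoly_ring_def mpoly_vars_def)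
qed

lemma mpoly_ring_mono: "R \<subseteq> R' \<Longrightarrow> V \<subseteq> V' \<Longrightarrow> mpoly_ring R V \<subseteq> mpoly_ring R' V'"
  by (auto simp: mpoly_ring_def)

lemma mpoly_ring_0: "0 \<in> mpoly_ring R V"
  by (simp add: mpoly_ring_def mpoly_vars_def)

lemma mpoly_ring_single:
  "c \<in> R \<Longrightarrow> Poly_Mapping.keys m \<subseteq> V \<Longrightarrow> Poly_Mapping.single m c \<in> mpoly_ring R V"
  by (simp add: mpoly_ring_def mpoly_vars_def)

lemma mpoly_ring_add:
  fixes R :: "'a::field set"
  assumes "subring R amb" "p \<in> mpoly_ring R V" "q \<in> mpoly_ring R V"
  shows "p + q \<in> mpoly_ring R V"
  unfolding mpoly_ring_iff[OF assms(1)]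
proof (intro conjI allI ballI)
  show "Poly_Mapping.lookup (p + q) m \<in> R" for m
    using assms(2,3) by (auto simp: lookup_add mpoly_ring_iff[OF assms(1)] intro!: subring_ambD(4)[OF assms(1)])
  fix m assume "m \<in> Poly_Mapping.keys (p + q)"
  hence "m \<in> Poly_Mapping.keys p \<or> m \<in> Poly_Mapping.keys q"
    using keys_add[of p q] by blast
  thus "Poly_Mapping.keys m \<subseteq> V"
    using assms(2,3) by (auto simp: mpoly_ring_iff[OF assms(1)])
qed

lemma mpoly_ring_sum:
  fixes R :: "'a::field set"
  assumes "subring R amb" "\<And>i. i \<in> A \<Longrightarrow> p i \<in> mpoly_ring R V"
  shows "(\<Sum>i\<in>A. p i) \<in> mpoly_ring R V"
  using assms(2)
  by (induction A rule: infinite_finite_induct) (auto simp: mpoly_ring_0 intro: mpoly_ring_add[OF assms(1)])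

lemma mpoly_eval_closed:
  fixes R :: "'a::field set"
  assumes "subring R amb" "p \<in> mpoly_ring R V" "\<And>v. v \<in> V \<Longrightarrow> x v \<in> R"
  shows "mpoly_eval x p \<in> R"
  unfolding mpoly_eval_def
  using assms(2,3)
  by (intro subring_amb_sum subring_ambD(5) subring_amb_prod subring_amb_power assms(1))
    (auto simp: mpoly_ring_iff[OF assms(1)])

lemma keys_diff_subset: "Poly_Mapping.keys (m - m') \<subseteq> Poly_Mapping.keys m" for m :: "'v \<Rightarrow>\<^sub>0 nat"
  by (auto simp: in_keys_iff lookup_minus)

lemma mpoly_deriv_closed:
  fixes R :: "'a::field set"
  assumes "subring R amb" "p \<in> mpoly_ring R V"
  shows "mpoly_deriv v p \<in> mpoly_ring R V"
  unfolding mpoly_deriv_def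
proof (intro mpoly_ring_sum mpoly_ring_single assms(1))
  fix m assume "m \<in> Poly_Mapping.keys p"
  then show "Poly_Mapping.keys (m - Poly_Mapping.single v 1) \<subseteq> V"
    using assms(2) keys_diff_subset[of m] unfolding mpoly_ring_iff[OF assms(1)] by blast
  show "of_nat (Poly_Mapping.lookup m v) * Poly_Mapping.lookup p m \<in> R"
    using assms(2) by (intro subring_ambD(5) subring_amb_of_nat assms(1))
      (auto simp: mpoly_ring_iff[OF assms(1)])
qed

text \<open>The values at \<open>x\<close> of polynomials over \<open>R\<close> form a subring;
  constants give \<open>R\<close> and single variables give the \<open>x v\<close>. It serves to
  write coefficients of the system for the upper extension as polynomials in the variables of the
  lower one.\<close>

lemma generate_ring_as_mpoly_eval:
  fixes R :: "'a::field set"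
  assumes R: "subring R amb" and "S \<subseteq> R \<union> x ` V" and a: "a \<in> generate_ring amb S"
  shows "\<exists>q\<in>mpoly_ring R V. mpoly_eval x q = a"
proof -
  let ?G = "mpoly_eval x ` mpoly_ring R V"
  have const: "c \<in> ?G" if "c \<in> R" for c
    using that by (intro image_eqI[of _ _ "Poly_Mapping.single 0 c"]) (auto intro: mpoly_ring_single)
  have mult: "mpoly_eval x p * mpoly_eval x q \<in> ?G"
    if p: "p \<in> mpoly_ring R V" and q: "q \<in> mpoly_ring R V" for p q
  proof
    \<comment> \<open>The product of \<open>p\<close> and \<open>q\<close>, multiplied out into
      monomials.\<close>
    let ?r = "\<Sum>m\<in>Poly_Mapping.keys p. \<Sum>k\<in>Poly_Mapping.keys q.
      Poly_Mapping.single (m + k) (Poly_Mapping.lookup p m * Poly_Mapping.lookup q k)"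
    show "?r \<in> mpoly_ring R V"
      using p q by (intro mpoly_ring_sum mpoly_ring_single R subring_ambD(5)[OF R]
        order_trans[OF keys_add]) (auto simp: mpoly_ring_iff[OF R])
    show "mpoly_eval x p * mpoly_eval x q = mpoly_eval x ?r"
      by (simp add: mpoly_eval_sum mon_eval_add mpoly_eval_superset[of "Poly_Mapping.keys p" p]
        mpoly_eval_superset[of "Poly_Mapping.keys q" q] sum_product mult_ac)
  qed
  have "subring ?G amb"
  proof (rule subring_ambI)
    show "1 \<in> ?G"
      using const subring_ambD(2)[OF R] by blast
    have m1: "- 1 \<in> ?G"
      using const subring_ambD(2,3)[OF R] by blast
    show "- a \<in> ?G" if a: "a \<in> ?G" for a
    proof -
      obtain p q where "p \<in> mpoly_ring R V" "q \<in> mpoly_ring R V" "- 1 = mpoly_eval x p" "a = mpoly_eval x q"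
        using m1 a by auto
      thus ?thesis
        using mult[of p q] by (simp flip: \<open>- 1 = _\<close>)
    qed
    show "a + b \<in> ?G" if "a \<in> ?G" "b \<in> ?G" for a b
      using that by (auto simp flip: mpoly_eval_add intro!: imageI mpoly_ring_add R)
    show "a * b \<in> ?G" if "a \<in> ?G" "b \<in> ?G" for a b
      using that mult by auto
  qed
  moreover have "x v \<in> ?G" if "v \<in> V" for v
    using that subring_ambD(2)[OF R]
    by (intro image_eqI[of _ _ "Poly_Mapping.single (Poly_Mapping.single v 1) 1"])
      (auto intro!: mpoly_ring_single)
  ultimately have "generate_ring amb S \<subseteq> ?G"
    using assms(2) const by (intro generate_amb_subset) auto
  with a show ?thesis
    by auto
qed

text \<open>The lift \<open>h\<close> replaces each coefficient of \<open>f\<close> by a polynomial in the variables below \<open>k\<close>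
  and shifts the variables of \<open>f\<close> by \<open>k\<close>.\<close>

lemma mpoly_lift_coeffs:
  fixes R :: "'a::field set" and f :: "(nat, 'a) mpoly"
  assumes R: "subring R amb" and vars: "mpoly_vars f \<subseteq> V"
    and coeffs: "\<And>c. c \<in> Poly_Mapping.range f \<Longrightarrow> \<exists>q\<in>mpoly_ring R {..<k}. mpoly_eval x q = c"
    and shift: "\<And>j. x (k + j) = y j"
  shows "\<exists>h\<in>mpoly_ring R ({..<k} \<union> (+) k ` V). mpoly_eval x h = mpoly_eval y f \<and>
    (\<forall>j. mpoly_eval x (mpoly_deriv (k + j) h) = mpoly_eval y (mpoly_deriv j f))"
proof -
  \<comment> \<open>On exponent vectors, \<open>sh\<close> renames variable \<open>i\<close> to
    \<open>k + i\<close>, which keeps the variables below \<open>k\<close> free for the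
    coefficients.\<close>
  define sh where "sh m = (\<Sum>i\<in>Poly_Mapping.keys m.
    Poly_Mapping.single (k + i) (Poly_Mapping.lookup m i))" for m :: "nat \<Rightarrow>\<^sub>0 nat"
  have lookup_sh: "Poly_Mapping.lookup (sh m) (k + j) = Poly_Mapping.lookup m j" for m j
  proof -
    have "Poly_Mapping.lookup (sh m) (k + j) =
        (\<Sum>i\<in>Poly_Mapping.keys m. if i = j then Poly_Mapping.lookup m j else 0)"
      unfolding sh_def lookup_sum by (intro sum.cong) (auto simp: lookup_single when_def)
    thus ?thesis
      by (simp add: in_keys_iff)
  qed
  have lookup_sh_low: "Poly_Mapping.lookup (sh m) j = 0" if "j < k" for m j
    unfolding sh_def lookup_sum using that by (intro sum.neutral) (auto simp: lookup_single when_def)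
  have keys_sh: "Poly_Mapping.keys (sh m) = (+) k ` Poly_Mapping.keys m" for m
  proof (rule Set.set_eqI)
    fix j
    show "j \<in> Poly_Mapping.keys (sh m) \<longleftrightarrow> j \<in> (+) k ` Poly_Mapping.keys m"
    proof (cases "j < k")
      case True
      then show ?thesis
        using lookup_sh_low[OF True] by (auto simp: in_keys_iff)
    next
      case False
      then obtain i where "j = k + i"
        using le_Suc_ex not_less by blast
      then show ?thesis
        using lookup_sh by (auto simp: in_keys_iff)
    qed
  qed
  have eval_sh: "mon_eval x (sh m) = mon_eval y m" for m
    by (simp add: mon_eval_def keys_sh prod.reindex lookup_sh shift)
  have sh_minus: "sh m - Poly_Mapping.single (k + j) 1 = sh (m - Poly_Mapping.single j 1)" for m j
  proof (rule poly_mapping_eqI)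
    fix i
    show "Poly_Mapping.lookup (sh m - Poly_Mapping.single (k + j) 1) i =
        Poly_Mapping.lookup (sh (m - Poly_Mapping.single j 1)) i"
    proof (cases "i < k")
      case True
      then show ?thesis
        by (simp add: lookup_minus lookup_sh_low)
    next
      case False
      then obtain l where "i = k + l"
        using le_Suc_ex not_less by blast
      then show ?thesis
        by (simp add: lookup_minus lookup_sh lookup_single when_def)
    qed
  qed
  obtain q where q: "\<And>c. c \<in> Poly_Mapping.range f \<Longrightarrow> q c \<in> mpoly_ring R {..<k}"
    and q_eval: "\<And>c. c \<in> Poly_Mapping.range f \<Longrightarrow> mpoly_eval x (q c) = c"
    using coeffs by metis
  let ?q = "\<lambda>m. q (Poly_Mapping.lookup f m)"
  \<comment> \<open>The sum over \<open>m\<close> of \<open>?q m\<close> times the monomial with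
    exponents \<open>sh m\<close>, multiplied out.\<close>
  define h where "h = (\<Sum>m\<in>Poly_Mapping.keys f. \<Sum>l\<in>Poly_Mapping.keys (?q m).
    Poly_Mapping.single (l + sh m) (Poly_Mapping.lookup (?q m) l))"
  have qk: "Poly_Mapping.keys l \<subseteq> {..<k}" "Poly_Mapping.lookup (?q m) l \<in> R"
    if "m \<in> Poly_Mapping.keys f" "l \<in> Poly_Mapping.keys (?q m)" for m l
    using q[of "Poly_Mapping.lookup f m"] that by (auto simp: mpoly_ring_iff[OF R])
  have expand: "(\<Sum>l\<in>Poly_Mapping.keys (?q m). Poly_Mapping.lookup (?q m) l * mon_eval x l) =
      Poly_Mapping.lookup f m" if "m \<in> Poly_Mapping.keys f" for m
    using q_eval[of "Poly_Mapping.lookup f m"] that by (simp add: mpoly_eval_superset[of "Poly_Mapping.keys (?q m)"])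
  have "h \<in> mpoly_ring R ({..<k} \<union> (+) k ` V)"
    unfolding h_def
  proof (intro mpoly_ring_sum mpoly_ring_single R order_trans[OF keys_add])
    fix m l assume m: "m \<in> Poly_Mapping.keys f" and l: "l \<in> Poly_Mapping.keys (?q m)"
    show "Poly_Mapping.lookup (?q m) l \<in> R"
      using qk m l by blast
    have "Poly_Mapping.keys m \<subseteq> V"
      using m vars by (auto simp: mpoly_vars_def)
    then show "Poly_Mapping.keys l \<union> Poly_Mapping.keys (sh m) \<subseteq> {..<k} \<union> (+) k ` V"
      using qk(1)[OF m l] by (auto simp: keys_sh)
  qed
  moreover have "mpoly_eval x h = mpoly_eval y f"
  proof -
    have "mpoly_eval x h = (\<Sum>m\<in>Poly_Mapping.keys f.
        (\<Sum>l\<in>Poly_Mapping.keys (?q m). Poly_Mapping.lookup (?q m) l * mon_eval x l) * mon_eval y m)"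
      by (simp add: h_def mpoly_eval_sum mon_eval_add eval_sh sum_distrib_right mult.assoc)
    also have "\<dots> = mpoly_eval y f"
      by (simp add: expand mpoly_eval_superset[of "Poly_Mapping.keys f" f])
    finally show ?thesis .
  qed
  moreover have "mpoly_eval x (mpoly_deriv (k + j) h) = mpoly_eval y (mpoly_deriv j f)" for j
  proof -
    let ?e = "Poly_Mapping.single j (1::nat)"
    \<comment> \<open>The variable \<open>k + j\<close> does not occur in \<open>l\<close>, so the
      lifted coefficients behave as constants and only the shifted monomial is
      differentiated.\<close>
    have deriv: "mpoly_deriv (k + j) (Poly_Mapping.single (l + sh m) c) =
        Poly_Mapping.single (l + sh (m - ?e)) (of_nat (Poly_Mapping.lookup m j) * c)"
      if "Poly_Mapping.keys l \<subseteq> {..<k}" for l m and c :: 'a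
    proof -
      have l: "Poly_Mapping.lookup l (k + j) = 0"
        using that by (auto simp: in_keys_iff subset_iff)
      have "l + sh m - Poly_Mapping.single (k + j) 1 = l + (sh m - Poly_Mapping.single (k + j) 1)"
        by (rule poly_mapping_eqI)
          (use l in \<open>auto simp: lookup_add lookup_minus lookup_single when_def\<close>)
      then show ?thesis
        by (simp add: lookup_add l lookup_sh sh_minus[simplified])
    qed
    have "mpoly_eval x (mpoly_deriv (k + j) h) = (\<Sum>m\<in>Poly_Mapping.keys f.
        \<Sum>l\<in>Poly_Mapping.keys (?q m). mpoly_eval x
          (Poly_Mapping.single (l + sh (m - ?e)) (of_nat (Poly_Mapping.lookup m j) * Poly_Mapping.lookup (?q m) l)))"
      unfolding h_def mpoly_deriv_sum mpoly_eval_sum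
      by (intro sum.cong refl arg_cong[of _ _ "mpoly_eval x"] deriv qk(1))
    also have "\<dots> = (\<Sum>m\<in>Poly_Mapping.keys f. of_nat (Poly_Mapping.lookup m j) *
        (\<Sum>l\<in>Poly_Mapping.keys (?q m). Poly_Mapping.lookup (?q m) l * mon_eval x l) * mon_eval y (m - ?e))"
      by (simp add: mon_eval_add eval_sh sum_distrib_right sum_distrib_left mult.assoc)
    also have "\<dots> = mpoly_eval y (mpoly_deriv j f)"
      by (simp add: expand mpoly_deriv_def mpoly_eval_sum)
    finally show ?thesis .
  qed
  ultimately show ?thesis
    by blast
qed


section \<open>Transcendence bases of towers\<close>

text \<open>Separates the two kinds of variables, so that a polynomial over \<open>K\<close> in
  \<open>S \<union> T\<close> can be read as one in \<open>T\<close> with coefficients in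
  \<open>K[S]\<close>.\<close>

definition mon_restrict :: "'v set \<Rightarrow> ('v \<Rightarrow>\<^sub>0 nat) \<Rightarrow> ('v \<Rightarrow>\<^sub>0 nat)" where
  "mon_restrict S = Poly_Mapping.mapp (\<lambda>v e. if v \<in> S then e else 0)"

lemma lookup_mon_restrict:
  "Poly_Mapping.lookup (mon_restrict S m) v = (if v \<in> S then Poly_Mapping.lookup m v else 0)"
  by (auto simp: mon_restrict_def lookup_mapp when_def in_keys_iff)

lemma keys_mon_restrict: "Poly_Mapping.keys (mon_restrict S m) \<subseteq> S"
  by (auto simp: in_keys_iff lookup_mon_restrict split: if_splits)

lemma mon_restrict_split:
  assumes "S \<inter> T = {}" "Poly_Mapping.keys m \<subseteq> S \<union> T"
  shows "mon_restrict S m + mon_restrict T m = m"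
  by (rule poly_mapping_eqI)
    (use assms in \<open>auto simp: lookup_add lookup_mon_restrict in_keys_iff subset_iff\<close>)

text \<open>A common element \<open>t\<close> would be a root of the nonzero polynomial
  \<open>X\<^sub>t - t\<close> over \<open>L\<close>.\<close>

lemma alg_indep_disjoint:
  fixes L :: "'a::field set"
  assumes L: "subring L amb" and T: "alg_indep L T"
  shows "L \<inter> T = {}"
proof -
  have False if "t \<in> L" "t \<in> T" for t
  proof -
    let ?p = "Poly_Mapping.single (Poly_Mapping.single t 1) 1 + Poly_Mapping.single 0 (- t) :: ('a, 'a) mpoly"
    have "?p \<in> mpoly_ring L T"
      using that subring_ambD(2,3)[OF L] by (intro mpoly_ring_add mpoly_ring_single L) auto
    moreover have "mpoly_eval (\<lambda>t. t) ?p = 0"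
      by (simp add: mpoly_eval_add)
    ultimately have "?p = 0"
      using T by (auto simp: alg_indep_def)
    hence "Poly_Mapping.lookup ?p (Poly_Mapping.single t 1) = 0"
      by simp
    moreover have "(0 :: 'a \<Rightarrow>\<^sub>0 nat) \<noteq> Poly_Mapping.single t 1"
      by (metis lookup_single_eq lookup_zero zero_neq_one)
    ultimately show False
      by (simp add: lookup_add lookup_single)
  qed
  thus ?thesis
    by blast
qed

text \<open>Group a relation by its monomials in \<open>T\<close>. Independence of \<open>T\<close>
  over \<open>L\<close> makes the value of each coefficient vanish; these coefficients are
  polynomials in \<open>S\<close> over \<open>K\<close>, so independence of \<open>S\<close> makes
  them zero.\<close>

lemma alg_indep_Un:
  fixes K L :: "'a::field set"
  assumes K: "subring K amb" and L: "subring L amb" and "K \<subseteq> L" "S \<subseteq> L"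
    and S: "alg_indep K S" and T: "alg_indep L T"
  shows "alg_indep K (S \<union> T)"
  unfolding alg_indep_def
proof (intro ballI impI)
  fix p assume p: "p \<in> mpoly_ring K (S \<union> T)" and p0: "mpoly_eval (\<lambda>t. t) p = 0"
  let ?ev = "mpoly_eval (\<lambda>t. t)" and ?M = "Poly_Mapping.keys p"
  have split: "mon_restrict S m + mon_restrict T m = m" if "m \<in> ?M" for m
    using that p \<open>S \<subseteq> L\<close> alg_indep_disjoint[OF L T]
    by (intro mon_restrict_split) (auto simp: mpoly_ring_iff[OF K])
  \<comment> \<open>\<open>G s\<close> holds the monomials of \<open>p\<close> with
    \<open>T\<close>-part \<open>s\<close>, and \<open>c s\<close> is the coefficient of
    \<open>s\<close> in \<open>K[S]\<close>. Evaluating these coefficients gives the polynomial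
    \<open>P\<close> over \<open>L\<close>.\<close>
  define G where "G s = {m \<in> ?M. mon_restrict T m = s}" for s
  define c where "c s = (\<Sum>m\<in>G s. Poly_Mapping.single (mon_restrict S m) (Poly_Mapping.lookup p m))" for s
  define P where "P = (\<Sum>s\<in>mon_restrict T ` ?M. Poly_Mapping.single s (?ev (c s)))"
  have c: "c s \<in> mpoly_ring K S" for s
    unfolding c_def using p
    by (intro mpoly_ring_sum mpoly_ring_single K keys_mon_restrict) (auto simp: mpoly_ring_iff[OF K])
  have "P \<in> mpoly_ring L T"
    unfolding P_def
  proof (intro mpoly_ring_sum mpoly_ring_single L)
    show "?ev (c s) \<in> L" for s
      using c[of s] mpoly_ring_mono[of K L S S] \<open>K \<subseteq> L\<close> \<open>S \<subseteq> L\<close>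
      by (intro mpoly_eval_closed[OF L, of _ S]) auto
    show "Poly_Mapping.keys s \<subseteq> T" if "s \<in> mon_restrict T ` ?M" for s
      using that keys_mon_restrict[of T] by blast
  qed
  moreover have "?ev P = 0"
  proof -
    have "?ev P = (\<Sum>s\<in>mon_restrict T ` ?M. \<Sum>m\<in>G s. Poly_Mapping.lookup p m *
        mon_eval (\<lambda>t. t) (mon_restrict S m + mon_restrict T m))"
      by (simp add: P_def c_def mpoly_eval_sum sum_distrib_right mon_eval_add mult.assoc G_def)
    also have "\<dots> = (\<Sum>s\<in>mon_restrict T ` ?M. \<Sum>m\<in>G s. Poly_Mapping.lookup p m * mon_eval (\<lambda>t. t) m)"
      by (intro sum.cong refl) (auto simp: G_def split)
    \<comment> \<open>The sets \<open>G s\<close> partition the monomials of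
      \<open>p\<close>.\<close>
    also have "\<dots> = ?ev p"
      unfolding G_def by (subst sum.image_gen[symmetric]) (simp_all add: mpoly_eval_superset[of ?M p])
    finally show ?thesis
      using p0 by simp
  qed
  ultimately have "P = 0"
    using T by (auto simp: alg_indep_def)
  have c0: "c s = 0" if "s \<in> mon_restrict T ` ?M" for s
  proof -
    have "Poly_Mapping.lookup P s = ?ev (c s)"
      using that by (simp add: P_def lookup_sum lookup_single when_def)
    hence "?ev (c s) = 0"
      using \<open>P = 0\<close> by simp
    thus ?thesis
      using c[of s] S unfolding alg_indep_def by blast
  qed
  have False if "m \<in> ?M" for m
  proof -
    let ?s = "mon_restrict T m"
    \<comment> \<open>Within \<open>G ?s\<close> a monomial is determined by its
      \<open>S\<close>-part, so no two terms of \<open>c ?s\<close> merge and the coefficient of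
      \<open>m\<close> in \<open>p\<close> survives.\<close>
    have "Poly_Mapping.lookup (c ?s) (mon_restrict S m) =
        (\<Sum>m'\<in>G ?s. if m' = m then Poly_Mapping.lookup p m else 0)"
      unfolding c_def lookup_sum
    proof (intro sum.cong refl)
      fix m' assume "m' \<in> G ?s"
      hence "mon_restrict S m' = mon_restrict S m \<longleftrightarrow> m' = m"
        using split that unfolding G_def by (metis (mono_tags, lifting) mem_Collect_eq)
      thus "Poly_Mapping.lookup (Poly_Mapping.single (mon_restrict S m') (Poly_Mapping.lookup p m'))
          (mon_restrict S m) = (if m' = m then Poly_Mapping.lookup p m else 0)"
        by (auto simp: lookup_single when_def)
    qed
    also have "\<dots> = Poly_Mapping.lookup p m"
      using that by (simp add: G_def)
    finally show False
      using c0[of ?s] that by (auto simp: in_keys_iff)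
  qed
  thus "p = 0"
    by (metis ex_in_conv keys_eq_empty)
qed

text \<open>The elements algebraic over \<open>K(S \<union> T)\<close> form a field
  \<open>M\<close>. It contains \<open>T\<close>, and \<open>L\<close> because \<open>L\<close> is
  algebraic over \<open>K(S)\<close>; hence it contains \<open>L(T)\<close>, over which
  \<open>E\<close> is algebraic.\<close>

lemma transcendence_basis_Un:
  fixes K L E :: "'a::field set"
  assumes K: "subfield K amb" and L: "subfield L amb" and "K \<subseteq> L" "L \<subseteq> E"
    and S: "transcendence_basis L K S" and T: "transcendence_basis E L T"
  shows "transcendence_basis E K (S \<union> T)"
proof -
  interpret field "amb :: 'a ring" by (rule field_from_type_algebra)
  let ?A = "adjoin K (S \<union> T)"
  define M where "M = {x. algebraic ?A x}"
  have M: "subfield M amb"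
    using subfield_of_algebraics[OF subfield_adjoin[of K "S \<union> T"]] by (simp add: M_def over_def)
  have "x \<in> M" if "x \<in> ?A" for x
    using algebraic_self[OF subfieldE(1)[OF subfield_adjoin[of K "S \<union> T"]] that] by (simp add: M_def over_def)
  hence "T \<subseteq> M"
    using adjoin_incl(2)[of "S \<union> T" K] by auto
  moreover have "L \<subseteq> M"
  proof
    fix x assume "x \<in> L"
    hence "(algebraic over adjoin K S) x"
      using S by (auto simp: transcendence_basis_def over_def)
    moreover have "adjoin K S \<subseteq> ?A"
      using adjoin_incl[where K = K and S = "S \<union> T"] by (intro adjoin_subset subfield_adjoin) auto
    ultimately show "x \<in> M"
      using algebraic_mono by (auto simp: M_def over_def)
  qed
  ultimately have LT: "adjoin L T \<subseteq> M"
    by (intro adjoin_subset M)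
  have "algebraic ?A x" if "x \<in> E" for x
  proof -
    have "(algebraic over ?A) x"
    proof (rule algebraic_trans)
      show "subfield ?A amb"
        by (rule subfield_adjoin)
      show "subring (adjoin L T) amb"
        by (rule subfieldE(1)[OF subfield_adjoin])
      show "(algebraic over ?A) y" if "y \<in> adjoin L T" for y
        using that LT by (auto simp: M_def over_def)
      show "(algebraic over adjoin L T) x"
        using T \<open>x \<in> E\<close> by (auto simp: transcendence_basis_def over_def)
    qed simp
    thus ?thesis
      by (simp add: over_def)
  qed
  moreover have "alg_indep K (S \<union> T)"
    using alg_indep_Un[OF subfieldE(1)[OF K] subfieldE(1)[OF L] \<open>K \<subseteq> L\<close>] S T
    by (auto simp: transcendence_basis_def)
  ultimately show ?thesis
    using S T \<open>L \<subseteq> E\<close> by (auto simp: transcendence_basis_def)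
qed


section \<open>Places and triangular Jacobians\<close>

lemma val_ring_mono: "L \<subseteq> E \<Longrightarrow> val_ring L P \<subseteq> val_ring E P"
  by (auto simp: val_ring_def)

lemma place_mult:
  "place E P \<Longrightarrow> a \<in> val_ring E P \<Longrightarrow> b \<in> val_ring E P \<Longrightarrow> P (a * b) = Some (the (P a) * the (P b))"
  by (auto simp: place_def val_ring_def)

lemma subring_val_ring:
  fixes E :: "'a::field set"
  assumes E: "subring E amb" and P: "place E P"
  shows "subring (val_ring E P) amb"
proof (rule subring_ambI)
  show "1 \<in> val_ring E P"
    using P subring_ambD(2)[OF E] by (auto simp: place_def val_ring_def)
  show mult: "a * b \<in> val_ring E P" if "a \<in> val_ring E P" "b \<in> val_ring E P" for a b
    using P that subring_ambD(5)[OF E] by (auto simp: place_def val_ring_def)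
  show "a + b \<in> val_ring E P" if "a \<in> val_ring E P" "b \<in> val_ring E P" for a b
    using P that subring_ambD(4)[OF E] by (auto simp: place_def val_ring_def)
  have m1: "- 1 \<in> E"
    using subring_ambD(2,3)[OF E] by blast
  \<comment> \<open>Negation is multiplication by \<open>- 1\<close>. An infinite value at
    \<open>- 1\<close> would give its inverse, again \<open>- 1\<close>, the value 0.\<close>
  have "P (- 1) \<noteq> None"
  proof
    assume "P (- 1) = None"
    moreover from this have "P (inverse (- 1)) = Some 0"
      using P m1 unfolding place_def by blast
    ultimately show False
      by simp
  qed
  with m1 have "- 1 \<in> val_ring E P"
    by (simp add: val_ring_def)
  thus "- a \<in> val_ring E P" if "a \<in> val_ring E P" for a
    using mult[OF _ that, of "- 1"] by simp
qed

text \<open>By (U1), an entry above the diagonal is the derivative by an absent variable, hence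
  0.\<close>

lemma det_jacobian_triangular:
  fixes f :: "nat \<Rightarrow> (nat, 'a::comm_ring_1) mpoly"
  assumes "\<forall>i j. i < j \<and> j < n \<longrightarrow> j \<notin> mpoly_vars (f i)"
  shows "det (jacobian n f \<eta>) = (\<Prod>i<n. mpoly_eval \<eta> (mpoly_deriv i (f i)))"
proof -
  have "det (jacobian n f \<eta>) = prod_list (diag_mat (jacobian n f \<eta>))"
    by (rule det_lower_triangular[of n])
      (use assms in \<open>auto simp: jacobian_def mpoly_deriv_not_var\<close>)
  thus ?thesis
    by (simp add: prod_list_diag_prod jacobian_def atLeast0LessThan)
qed

text \<open>With a valuation ring as \<open>R\<close>, this excludes the value \<open>None\<close>,
  which the condition \<open>P (det (jacobian n f \<eta>)) \<noteq> Some 0\<close> by itself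
  admits.\<close>

lemma det_jacobian_in_val_ring:
  fixes f :: "nat \<Rightarrow> (nat, 'a::field) mpoly"
  assumes R: "subring R amb" and "\<forall>i<n. f i \<in> mpoly_ring R {..<n}" "\<eta> ` {..<n} \<subseteq> R"
    and "\<forall>i j. i < j \<and> j < n \<longrightarrow> j \<notin> mpoly_vars (f i)"
  shows "det (jacobian n f \<eta>) \<in> R"
  unfolding det_jacobian_triangular[OF assms(4)] using assms(2,3)
  by (intro subring_amb_prod R mpoly_eval_closed[OF R mpoly_deriv_closed[OF R]]) auto

section \<open>Composing uniformizing systems\<close>

theorem theorem1p2:
  fixes K L F :: "'a::field set" and P :: "'a \<Rightarrow> 'r::field option"
  assumes "subfield K amb" and "subfield L amb" and "subfield F amb"
    and "K \<subseteq> L" and "L \<subseteq> F"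
    and "fin_gen F L" and "fin_gen L K"
    and "place F P"
    and "uniformizable F L P" and "uniformizable L K P"
  shows "uniformizable F K P"
  unfolding uniformizable_def
proof (intro allI impI, elim conjE)
  fix Z assume Z: "finite Z" "Z \<subseteq> val_ring F P"
  have OF: "subring (val_ring F P) amb"
    by (rule subring_val_ring[OF subfieldE(1)[OF assms(3)] \<open>place F P\<close>])
  have KLF: "val_ring K P \<subseteq> val_ring L P" "val_ring L P \<subseteq> val_ring F P"
    using assms(4,5) by (simp_all add: val_ring_mono)
  have "uniformizable_wrt F L P Z"
    using \<open>uniformizable F L P\<close> Z unfolding uniformizable_def by blast
  then obtain T n y f where T: "finite T" "T \<subseteq> val_ring F P" "transcendence_basis F L T"
    and y: "y ` {..<n} \<subseteq> val_ring F P" "Z \<subseteq> y ` {..<n}"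
    and f: "\<forall>i<n. f i \<in> mpoly_ring (generate_ring amb (val_ring L P \<union> T)) {..<n}"
    and F_eq: "F = adjoin L (T \<union> y ` {..<n})"
    and f_tri: "\<forall>i j. i < j \<and> j < n \<longrightarrow> j \<notin> mpoly_vars (f i)"
    and f_root: "\<forall>i<n. mpoly_eval y (f i) = 0"
    and f_det: "P (det (jacobian n f y)) \<noteq> Some 0"
    unfolding uniformizable_wrt_def by (elim exE conjE) (rule that; assumption)
  \<comment> \<open>All nonzero coefficients of the system for \<open>F|L\<close>. Below,
    \<open>C a\<close> collects the elements of \<open>\<O>\<^sub>L\<close> needed to express
    \<open>a\<close>.\<close>
  define A where "A = (\<Union>i<n. Poly_Mapping.range (f i))"
  have "finite A"
    by (simp add: A_def)
  have "\<forall>a\<in>A. \<exists>C\<subseteq>val_ring L P. finite C \<and> a \<in> generate_ring amb (C \<union> T)"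
    using f by (intro ballI generate_ring_finite_part) (auto simp: A_def mpoly_ring_def)
  then obtain C where C: "\<And>a. a \<in> A \<Longrightarrow> C a \<subseteq> val_ring L P" "\<And>a. a \<in> A \<Longrightarrow> finite (C a)"
    "\<And>a. a \<in> A \<Longrightarrow> a \<in> generate_ring amb (C a \<union> T)"
    by metis
  have "finite (\<Union>(C ` A))" "\<Union>(C ` A) \<subseteq> val_ring L P"
    using \<open>finite A\<close> C(1,2) by auto
  hence "uniformizable_wrt L K P (\<Union>(C ` A))"
    using \<open>uniformizable L K P\<close> unfolding uniformizable_def by blast
  then obtain S k x g where S: "finite S" "S \<subseteq> val_ring L P" "transcendence_basis L K S"
    and x: "x ` {..<k} \<subseteq> val_ring L P" "\<Union>(C ` A) \<subseteq> x ` {..<k}"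
    and g: "\<forall>i<k. g i \<in> mpoly_ring (generate_ring amb (val_ring K P \<union> S)) {..<k}"
    and L_eq: "L = adjoin K (S \<union> x ` {..<k})"
    and g_tri: "\<forall>i j. i < j \<and> j < k \<longrightarrow> j \<notin> mpoly_vars (g i)"
    and g_root: "\<forall>i<k. mpoly_eval x (g i) = 0"
    and g_det: "P (det (jacobian k g x)) \<noteq> Some 0"
    unfolding uniformizable_wrt_def by (elim exE conjE) (rule that; assumption)
  \<comment> \<open>The coefficient ring \<open>\<O>\<^sub>K[S \<union> T]\<close> prescribed for
    the combined system.\<close>
  let ?R = "generate_ring amb (val_ring K P \<union> (S \<union> T))"
  have R: "subring ?R amb"
    by (rule subring_generate_amb)
  \<comment> \<open>The elements for \<open>L|K\<close> come first: the lifted polynomials involve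
    their variables, and (U1) permits only variables of index at most that of the
    polynomial.\<close>
  define z where "z i = (if i < k then x i else y (i - k))" for i
  have z_low: "i < k \<Longrightarrow> z i = x i" and z_shift: "z (k + i) = y i" for i
    by (simp_all add: z_def)
  have z_image: "z ` {..<k + n} = x ` {..<k} \<union> y ` {..<n}"
  proof -
    have "{..<k + n} = {..<k} \<union> (+) k ` {..<n}"
      by (simp add: lessThan_atLeast0 image_add_atLeastLessThan ivl_disj_un_two(3) add.commute)
    thus ?thesis
      by (simp add: image_Un image_image z_low z_shift)
  qed
  have coeffs: "\<exists>q\<in>mpoly_ring ?R {..<k}. mpoly_eval z q = a" if "a \<in> A" for a
  proof (rule generate_ring_as_mpoly_eval[OF R _ C(3)[OF that]])
    have "z ` {..<k} = x ` {..<k}"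
      by (simp add: z_low)
    hence "C a \<subseteq> z ` {..<k}"
      using x(2) that by auto
    thus "C a \<union> T \<subseteq> ?R \<union> z ` {..<k}"
      by (auto intro: generate_ring.incl)
  qed
  \<comment> \<open>The bound \<open>{..i}\<close> in place of \<open>{..<n}\<close> carries (U1)
    over to the lifts.\<close>
  have "\<forall>i<n. \<exists>h\<in>mpoly_ring ?R ({..<k} \<union> (+) k ` {..i}). mpoly_eval z h = mpoly_eval y (f i) \<and>
    (\<forall>j. mpoly_eval z (mpoly_deriv (k + j) h) = mpoly_eval y (mpoly_deriv j (f i)))"
  proof (intro allI impI mpoly_lift_coeffs R coeffs z_shift)
    fix i assume "i < n"
    show "mpoly_vars (f i) \<subseteq> {..i}"
    proof
      fix j assume "j \<in> mpoly_vars (f i)"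
      moreover from this have "j < n"
        using f \<open>i < n\<close> by (auto simp: mpoly_ring_def)
      ultimately show "j \<in> {..i}"
        using f_tri by (meson atMost_iff not_le)
    qed
    show "c \<in> A" if "c \<in> Poly_Mapping.range (f i)" for c
      using that \<open>i < n\<close> by (auto simp: A_def)
  qed
  then obtain h where h: "\<And>i. i < n \<Longrightarrow> h i \<in> mpoly_ring ?R ({..<k} \<union> (+) k ` {..i})"
    and h_eval: "\<And>i. i < n \<Longrightarrow> mpoly_eval z (h i) = mpoly_eval y (f i)"
    and h_deriv: "\<And>i j. i < n \<Longrightarrow> mpoly_eval z (mpoly_deriv (k + j) (h i)) = mpoly_eval y (mpoly_deriv j (f i))"
    by metis
  define u where "u i = (if i < k then g i else h (i - k))" for i
  have u_low: "i < k \<Longrightarrow> u i = g i" and u_shift: "u (k + i) = h i" for i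
    by (simp_all add: u_def)
  have g_vars: "mpoly_vars (g i) \<subseteq> {..<k}" if "i < k" for i
    using g that by (auto simp: mpoly_ring_def)
  have g_eval: "mpoly_eval z p = mpoly_eval x p" if "mpoly_vars p \<subseteq> {..<k}" for p
    using that by (intro mpoly_eval_cong) (auto simp: z_low)
  have g_deriv_vars: "mpoly_vars (mpoly_deriv j (g i)) \<subseteq> {..<k}" if "i < k" for i j
    using mpoly_deriv_closed[OF subring_generate_amb g[rule_format, OF that]] by (auto simp: mpoly_ring_def)
  have low_or_shift: "i < k \<or> (\<exists>i'<n. i = k + i')" if "i < k + n" for i
    using that by presburger
  have u: "u i \<in> mpoly_ring ?R {..<k + n}" if "i < k + n" for i
    using low_or_shift[OF that]
  proof (elim disjE exE conjE)
    assume "i < k"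
    have "mpoly_ring (generate_ring amb (val_ring K P \<union> S)) {..<k} \<subseteq> mpoly_ring ?R {..<k + n}"
      by (intro mpoly_ring_mono generate_amb_mono) auto
    then show ?thesis
      using g \<open>i < k\<close> by (auto simp: u_low)
  next
    fix i' assume i': "i' < n" "i = k + i'"
    hence "mpoly_ring ?R ({..<k} \<union> (+) k ` {..i'}) \<subseteq> mpoly_ring ?R {..<k + n}"
      by (intro mpoly_ring_mono) auto
    then show ?thesis
      using h i' by (auto simp: u_shift)
  qed
  have u_tri: "\<forall>i j. i < j \<and> j < k + n \<longrightarrow> j \<notin> mpoly_vars (u i)"
  proof (intro allI impI, elim conjE)
    fix i j assume ij: "i < j" "j < k + n"
    hence "i < k + n"
      by simp
    from low_or_shift[OF this] show "j \<notin> mpoly_vars (u i)"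
    proof (elim disjE exE conjE)
      assume "i < k"
      then show ?thesis
        using ij g_tri g_vars[of i] by (cases "j < k") (auto simp: u_low)
    next
      fix i' assume "i' < n" "i = k + i'"
      then show ?thesis
        using ij h[of i'] by (auto simp: u_shift mpoly_ring_def)
    qed
  qed
  have u_root: "mpoly_eval z (u i) = 0" if "i < k + n" for i
    using low_or_shift[OF that]
    by (auto simp: u_low u_shift g_eval g_vars g_root h_eval f_root)
  have u_det: "det (jacobian (k + n) u z) = det (jacobian k g x) * det (jacobian n f y)"
  proof -
    have "det (jacobian (k + n) u z) = (\<Prod>i<k. mpoly_eval z (mpoly_deriv i (u i))) *
        (\<Prod>i<n. mpoly_eval z (mpoly_deriv (k + i) (u (k + i))))"
      unfolding det_jacobian_triangular[OF u_tri] by (induction n) (simp_all add: mult.assoc)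
    \<comment> \<open>The first factors involve only variables below \<open>k\<close>, where
      \<open>z\<close> agrees with \<open>x\<close>; the others are preserved by the lift.\<close>
    also have "\<dots> = det (jacobian k g x) * det (jacobian n f y)"
      by (simp add: det_jacobian_triangular[OF g_tri] det_jacobian_triangular[OF f_tri]
        u_low u_shift g_eval g_deriv_vars h_deriv)
    finally show ?thesis .
  qed
  have "generate_ring amb (val_ring K P \<union> S) \<subseteq> val_ring F P"
    using S(2) KLF by (intro generate_amb_subset OF) auto
  hence g_F: "det (jacobian k g x) \<in> val_ring F P"
    using x(1) KLF g mpoly_ring_mono[of _ "val_ring F P" "{..<k}" "{..<k}"]
    by (intro det_jacobian_in_val_ring OF g_tri) blast+
  have "generate_ring amb (val_ring L P \<union> T) \<subseteq> val_ring F P"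
    using T(2) KLF by (intro generate_amb_subset OF) auto
  hence f_F: "det (jacobian n f y) \<in> val_ring F P"
    using y(1) f mpoly_ring_mono[of _ "val_ring F P" "{..<n}" "{..<n}"]
    by (intro det_jacobian_in_val_ring OF f_tri) blast+
  \<comment> \<open>Both determinants have finite nonzero residues, and these lie in a field, so
    their product is nonzero.\<close>
  have "P (det (jacobian (k + n) u z)) \<noteq> Some 0"
    using place_mult[OF \<open>place F P\<close> g_F f_F] g_F f_F g_det f_det
    unfolding u_det by (auto simp: val_ring_def)
  moreover have "finite (S \<union> T)" "S \<union> T \<subseteq> val_ring F P"
    using S T KLF by auto
  moreover have "transcendence_basis F K (S \<union> T)"
    by (rule transcendence_basis_Un[OF assms(1,2,4,5) S(3) T(3)])
  moreover have "z ` {..<k + n} \<subseteq> val_ring F P" "Z \<subseteq> z ` {..<k + n}"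
    using x(1) y KLF by (auto simp: z_image)
  moreover have "F = adjoin K ((S \<union> T) \<union> z ` {..<k + n})"
    unfolding z_image by (subst F_eq, subst L_eq) (simp add: adjoin_adjoin Un_ac)
  ultimately show "uniformizable_wrt F K P Z"
    unfolding uniformizable_wrt_def using u u_tri u_root by blast
qed

end
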